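(* Let $Y$ be a Banach space and let $E$ be a norming closed linear subspace of $Y^*$. A Banach action $A\times X\to Y$, $(a,x)\mapsto ax$, is unconditional if and only if for every $y^*\in E$ the operator $D_{y^*}:X\to A^*$ defined by $D_{y^*}(x)(a)=y^*(ax)$ for $x\in X$, $a\in A$, is absolutely summing.
   Context: All Banach spaces are over the field $\mathbb F$ of real or complex numbers; $Z^*$ denotes the dual Banach space of a Banach space $Z$; $\omega=\{0,1,2,\dots\}$, $\mathbb N=\omega\setminus\{0\}$, and each $n\in\omega$ is identified with the set $\{0,\dots,n-1\}$. A Banach action is a continuous bilinear function $A\times X\to Y$, $(a,x)\mapsto ax$, where $A,X,Y$ are Banach spaces (over the same field $\mathbb F$). A Banach action $A\times X\to Y$ is called unconditional if there exists a positive real number $C$ such that for every $n\in\mathbb N$ and all sequences $(a_k)_{k\in n}$ in $A$ and $(x_k)_{k\in n}$ in $X$ we have $$\Big\|\sum_{k\in n}a_kx_k\Big\|_Y\le C\cdot\max_{k\in n}\|a_k\|_A\cdot\max_{F\subseteq n}\Big\|\sum_{k\in F}x_k\Big\|_X.$$ A subspace $E\subseteq Y^*$ is called norming if there exists a real constant $c$ such that $\|y\|\le c\sup_{y^*\in S_E}|y^*(y)|$ for every $y\in Y$, where $S_E=\{e\in E:\|e\|=1\}$. A series $\sum_{n\in\omega}x_n$ in a Banach space $X$ converges unconditionally if for every permutation $\sigma$ of $\omega$ the series $\sum_{n\in\omega}x_{\sigma(n)}$ converges in $X$. An operator $T:X\to Z$ between Banach spaces is absolutely summing if for every unconditionally convergent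 series $\sum_{n\in\omega}x_n$ in $X$ we have $\sum_{n\in\omega}\|T(x_n)\|<\infty$. *)

theory Defs
  imports "HOL-Analysis.Analysis"
begin

text \<open>The scalar field is a type \<open>'f\<close> of sort \<open>{real_normed_field, banach}\<close>. Both \<open>real\<close> and \<open>complex\<close>
  are instances, and by the Gelfand--Mazur theorem they are the only ones up to isomorphism.

  A Banach space over \<open>'f\<close> is a type of class \<open>banach\<close> with a scalar multiplication by \<open>'f\<close> that
  extends the built-in real one; for \<open>'f = real\<close> this forces \<open>scale = scaleR\<close>.\<close>

locale banach_space_over = vector_space scale
  for scale :: "'f::{real_normed_field, banach} \<Rightarrow> 'x::banach \<Rightarrow> 'x" +
  assumes scale_of_real: "scale (of_real r) x = r *\<^sub>R x"
    and norm_scale: "norm (scale c x) = norm c * norm x"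

locale banach_action =
  A: banach_space_over sA + X: banach_space_over sX + Y: banach_space_over sY
  for sA :: "'f::{real_normed_field, banach} \<Rightarrow> 'a::banach \<Rightarrow> 'a"
    and sX :: "'f \<Rightarrow> 'x::banach \<Rightarrow> 'x"
    and sY :: "'f \<Rightarrow> 'y::banach \<Rightarrow> 'y" +
  fixes act :: "'a \<Rightarrow> 'x \<Rightarrow> 'y"
  assumes linear_left: "Vector_Spaces.linear sA sY (\<lambda>a. act a x)"
    and linear_right: "Vector_Spaces.linear sX sY (\<lambda>x. act a x)"
    and continuous_act: "continuous_on UNIV (\<lambda>(a, x). act a x)"

definition unconditional_action :: "('a::banach \<Rightarrow> 'x::banach \<Rightarrow> 'y::banach) \<Rightarrow> bool"
  where "unconditional_action act \<longleftrightarrow>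
    (\<exists>C>0. \<forall>n\<ge>1. \<forall>(a :: nat \<Rightarrow> 'a) (x :: nat \<Rightarrow> 'x).
      norm (\<Sum>k<n. act (a k) (x k))
        \<le> C * (MAX k\<in>{..<n}. norm (a k)) * (MAX F\<in>Pow {..<n}. norm (\<Sum>k\<in>F. x k)))"

text \<open>The type \<open>'z \<Rightarrow>\<^sub>L 'f\<close> contains all bounded real-linear maps; the dual space over \<open>'f\<close> consists of
  the \<open>'f\<close>-linear ones. It carries the operator norm inherited from \<open>'z \<Rightarrow>\<^sub>L 'f\<close>.\<close>

definition dual_space ::
    "('f::{real_normed_field, banach} \<Rightarrow> 'z::banach \<Rightarrow> 'z) \<Rightarrow> ('z \<Rightarrow>\<^sub>L 'f) set"
  where "dual_space s = {f. Vector_Spaces.linear s (*) (blinfun_apply f)}"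

definition dual_scale ::
    "'f::{real_normed_field, banach} \<Rightarrow> ('z::banach \<Rightarrow>\<^sub>L 'f) \<Rightarrow> ('z \<Rightarrow>\<^sub>L 'f)"
  where "dual_scale c f = blinfun_mult_right c o\<^sub>L f"

lemma dual_scale_apply [simp]: "blinfun_apply (dual_scale c f) z = c * blinfun_apply f z"
  by (simp add: dual_scale_def)

lemma vector_space_dual_scale: "vector_space dual_scale"
  by unfold_locales (auto intro!: blinfun_eqI simp: algebra_simps blinfun.add_left)

text \<open>For \<open>E = {0}\<close> the supremum below ranges over the empty set and has an unspecified real value.
  This is harmless: an inequality with a right-hand side independent of \<open>y\<close> can hold for
  all \<open>y\<close> only if the space is trivial, and then \<open>c = 0\<close> works.\<close>

definition norming :: "('y::banach \<Rightarrow>\<^sub>L 'f::{real_normed_field, banach}) set \<Rightarrow> bool"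
  where "norming E \<longleftrightarrow>
    (\<exists>c::real. \<forall>y. norm y \<le> c * (SUP f\<in>{e \<in> E. norm e = 1}. norm (blinfun_apply f y)))"

definition unconditionally_convergent :: "(nat \<Rightarrow> 'x::banach) \<Rightarrow> bool"
  where "unconditionally_convergent x \<longleftrightarrow>
    (\<forall>\<sigma>::nat \<Rightarrow> nat. bij \<sigma> \<longrightarrow> summable (\<lambda>n. x (\<sigma> n)))"

definition absolutely_summing ::
    "('f::{real_normed_field, banach} \<Rightarrow> 'x::banach \<Rightarrow> 'x) \<Rightarrow> ('f \<Rightarrow> 'z::banach \<Rightarrow> 'z)
      \<Rightarrow> ('x \<Rightarrow> 'z) \<Rightarrow> bool"
  where "absolutely_summing sX sZ T \<longleftrightarrow>
    Vector_Spaces.linear sX sZ T \<and> continuous_on UNIV T \<and>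
    (\<forall>x. unconditionally_convergent x \<longrightarrow> summable (\<lambda>n. norm (T (x n))))"

definition D_operator ::
    "('a::banach \<Rightarrow> 'x::banach \<Rightarrow> 'y::banach) \<Rightarrow> ('y \<Rightarrow>\<^sub>L 'f::{real_normed_field, banach})
      \<Rightarrow> 'x \<Rightarrow> ('a \<Rightarrow>\<^sub>L 'f)"
  where "D_operator act f x = Blinfun (\<lambda>a. blinfun_apply f (act a x))"

text \<open>\<open>Blinfun\<close> is meaningful only on bounded linear maps; the next two facts show that for a Banach
  action \<open>D_operator\<close> is given by the expected formula and takes values in the dual space.\<close>

context banach_action
begin

lemma bounded_linear_act_left: "bounded_linear (\<lambda>a. act a x)"
proof -
  interpret L: Vector_Spaces.linear sA sY "\<lambda>a. act a x" by (rule linear_left)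
  have lin: "linear (\<lambda>a. act a x)"
  proof (rule linearI)
    show "act (a + b) x = act a x + act b x" for a b by (rule L.add)
    show "act (r *\<^sub>R a) x = r *\<^sub>R act a x" for r a
      using L.scale[of "of_real r" a] by (simp add: A.scale_of_real Y.scale_of_real)
  qed
  have "continuous_on UNIV ((\<lambda>(a, x). act a x) \<circ> (\<lambda>a. (a, x)))"
    by (rule continuous_on_compose) (auto intro!: continuous_intros
        intro: continuous_on_subset[OF continuous_act])
  then have "continuous_on UNIV (\<lambda>a. act a x)" by (simp add: o_def)
  then have "isCont (\<lambda>a. act a x) 0" by (simp add: continuous_on_eq_continuous_at)
  then have "((\<lambda>a. act a x) \<longlongrightarrow> 0) (at 0)"
    using linear_0[OF lin] by (simp add: isCont_def)
  then have "\<forall>\<^sub>F a in at 0. norm (act a x) < 1"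
    using order_tendstoD(2)[OF tendsto_norm, of _ 0 "at 0" 1] by fastforce
  then obtain d where d: "d > 0" "\<And>a. a \<noteq> 0 \<Longrightarrow> norm a < d \<Longrightarrow> norm (act a x) < 1"
    by (auto simp: eventually_at dist_norm)
  have "norm (act a x) \<le> norm a * (2 / d)" for a
  proof (cases "a = 0")
    case True then show ?thesis using linear_0[OF lin] by simp
  next
    case False
    let ?r = "d / (2 * norm a)"
    have "norm (act (?r *\<^sub>R a) x) < 1" using False d(1) by (intro d(2)) auto
    then have "?r * norm (act a x) < 1" using d(1) by (simp add: linear_cmul[OF lin])
    then show ?thesis using False d(1) by (simp add: field_simps)
  qed
  then show ?thesis
    using linear_add[OF lin] linear_cmul[OF lin] by (intro bounded_linear_intro)
qed

lemma D_operator_apply: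
  "blinfun_apply (D_operator act f x) a = blinfun_apply f (act a x)"
  unfolding D_operator_def
  by (subst bounded_linear_Blinfun_apply)
    (auto intro: bounded_linear_compose[OF blinfun.bounded_linear_right bounded_linear_act_left])

lemma D_operator_in_dual_space:
  assumes "f \<in> dual_space sY"
  shows "D_operator act f x \<in> dual_space sA"
proof -
  have f: "Vector_Spaces.linear sY (*) (blinfun_apply f)"
    using assms by (simp add: dual_space_def)
  have "Vector_Spaces.linear sA (*) (blinfun_apply f \<circ> (\<lambda>a. act a x))"
    by (rule Vector_Spaces.linear_compose[OF linear_left f])
  moreover have "blinfun_apply f \<circ> (\<lambda>a. act a x) = blinfun_apply (D_operator act f x)"
    by (simp add: fun_eq_iff D_operator_apply)
  ultimately show ?thesis by (simp add: dual_space_def)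
qed

end

end

theory Submission imports Defs begin

text \<open>
  Both directions compare the vectors \<open>\<Sum>k<n. a\<^sub>k x\<^sub>k\<close> with the sums \<open>\<Sum>k<n. \<parallel>D\<^sub>f x\<^sub>k\<parallel>\<close>. Since
  \<open>f (a x) = D\<^sub>f x a\<close>, choosing each \<open>a\<^sub>k\<close> in the unit ball so that \<open>D\<^sub>f x\<^sub>k a\<^sub>k\<close> is nonnegative and at
  least half of \<open>\<parallel>D\<^sub>f x\<^sub>k\<parallel>\<close> shows that up to the factor \<open>2\<close> the latter sum is the supremum of
  \<open>\<bar>f (\<Sum>k<n. a\<^sub>k x\<^sub>k)\<bar>\<close> over all \<open>a\<close> with \<open>\<parallel>a\<^sub>k\<parallel> \<le> 1\<close>.

  If the action is unconditional and \<open>\<Sum>x\<^sub>k\<close> converges unconditionally, then the finite subsums of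
  \<open>\<Sum>x\<^sub>k\<close> are bounded (\<open>unconditionally_convergent_finite_sums_bounded\<close>), hence so are the partial
  sums of \<open>\<Sum>\<parallel>D\<^sub>f x\<^sub>k\<parallel>\<close>.

  Conversely, an absolutely summing operator satisfies a finite estimate: \<open>\<Sum>k<n. \<parallel>T x\<^sub>k\<parallel>\<close> is
  bounded uniformly over all finite families whose subsums lie in the unit ball
  (\<open>absolutely_summing_finite_bound\<close>); otherwise ever worse families, scaled down geometrically and
  enumerated together, would form an unconditionally convergent series violating the definition. So for each \<open>f \<in> E\<close> the functional \<open>f\<close> is bounded on the set of all
  \<open>\<Sum>k<n. a\<^sub>k x\<^sub>k\<close> with all \<open>a\<^sub>k\<close> and all subsums of \<open>x\<close> in the unit balls.
  As \<open>E\<close> is a Banach space, the uniform boundedness principle (\<open>uniform_boundedness\<close>), applied to the evaluations at these vectors, makes the bound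
  uniform over the unit sphere of \<open>E\<close>, and \<open>E\<close> being norming turns it into a bound on their norms.
\<close>

section \<open>Unconditionally convergent series and absolutely summing operators\<close>

text \<open>If the finite sums were unbounded, then every finite list of indices could be prolonged to
  one over which the sum is as large as desired, as the new indices can outweigh the old ones.
  Prolonging infinitely often, and adding the index \<open>i\<close> in the \<open>i\<close>-th step, enumerates all indices
  in an order for which the partial sums are unbounded.\<close>

lemma unconditionally_convergent_finite_sums_bounded:
  fixes x :: "nat \<Rightarrow> 'x::banach"
  assumes "unconditionally_convergent x"
  obtains M where "\<And>F. finite F \<Longrightarrow> norm (\<Sum>k\<in>F. x k) \<le> M"
proof (rule ccontr)
  assume "\<not> thesis"
  then have large: "\<exists>F. finite F \<and> norm (\<Sum>k\<in>F. x k) > M" for M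
    using that by (meson not_le)
  define P where "P = (\<lambda>i L. distinct L \<and> {..<i} \<subseteq> set L \<and> real i \<le> norm (\<Sum>k\<in>set L. x k))"
  have "\<exists>L. \<forall>i. P i (L i) \<and> (\<exists>ys. L (Suc i) = L i @ ys)"
  proof (rule dependent_nat_choice)
    show "\<exists>L. P 0 L"
      by (rule exI[of _ "[]"]) (simp add: P_def)
  next
    fix L i
    assume L: "P i L"
    define G where "G = insert i (set L)"
    obtain F where F: "finite F" "norm (\<Sum>k\<in>F. x k) > real (Suc i) + (\<Sum>k\<in>G. norm (x k))"
      using large by blast
    have G: "finite G" by (simp add: G_def)
    define ys where "ys = sorted_list_of_set ((F \<union> G) - set L)"
    have set_ys: "set ys = (F \<union> G) - set L"
      using F(1) G by (simp add: ys_def)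
    then have set_L: "set (L @ ys) = F \<union> G"
      by (auto simp: G_def)
    have "(\<Sum>k\<in>F. x k) = (\<Sum>k\<in>F \<union> G. x k) - (\<Sum>k\<in>G - F. x k)"
      using sum.subset_diff[of F "F \<union> G" x] F(1) G
      by (simp add: algebra_simps Un_Diff)
    then have "norm (\<Sum>k\<in>F. x k) \<le> norm (\<Sum>k\<in>F \<union> G. x k) + norm (\<Sum>k\<in>G - F. x k)"
      using norm_triangle_ineq4 by metis
    moreover have "norm (\<Sum>k\<in>G - F. x k) \<le> (\<Sum>k\<in>G. norm (x k))"
      by (rule order_trans[OF norm_sum]) (use G in \<open>auto intro: sum_mono2\<close>)
    ultimately have "real (Suc i) \<le> norm (\<Sum>k\<in>set (L @ ys). x k)"
      using F(2) unfolding set_L by linarith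
    moreover have "distinct (L @ ys)"
      using L set_ys by (auto simp: P_def ys_def)
    moreover have "{..<Suc i} \<subseteq> set (L @ ys)"
      using L unfolding set_L G_def P_def by (auto simp: less_Suc_eq)
    ultimately have "P (Suc i) (L @ ys)"
      unfolding P_def by blast
    then show "\<exists>L'. P (Suc i) L' \<and> (\<exists>ys. L' = L @ ys)"
      by blast
  qed
  then obtain L where L: "\<And>i. P i (L i)" and extend: "\<And>i. \<exists>ys. L (Suc i) = L i @ ys"
    by blast
  have prefix: "\<exists>ys. L j = L i @ ys" if "i \<le> j" for i j
    using that
  proof (induction rule: dec_induct)
    case (step n)
    then show ?case using extend[of n] by (metis append.assoc)
  qed simp
  have len: "i \<le> length (L i)" for i
    using card_mono[of "set (L i)" "{..<i}"] L[of i] distinct_card[of "L i"] by (simp add: P_def)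
  define \<sigma> where "\<sigma> n = L (Suc n) ! n" for n
  have \<sigma>: "\<sigma> n = L i ! n" if "n < length (L i)" for n i
  proof (cases "Suc n \<le> i")
    case True
    then show ?thesis
      using prefix[OF True] len[of "Suc n"] by (auto simp: \<sigma>_def nth_append)
  next
    case False
    then have "i \<le> Suc n" by simp
    then show ?thesis
      using prefix[of i "Suc n"] that by (auto simp: \<sigma>_def nth_append)
  qed
  have "inj \<sigma>"
  proof (rule injI)
    fix m n
    assume eq: "\<sigma> m = \<sigma> n"
    define i where "i = Suc (max m n)"
    have "m < length (L i)" "n < length (L i)"
      using len[of i] by (auto simp: i_def)
    then show "m = n"
      using eq \<sigma>[of m i] \<sigma>[of n i] L[of i] by (simp add: P_def nth_eq_iff_index_eq)
  qed
  moreover have "surj \<sigma>"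
    unfolding surj_def
  proof
    fix k
    have "k \<in> set (L (Suc k))"
      using L[of "Suc k"] by (auto simp: P_def)
    then show "\<exists>n. k = \<sigma> n"
      using \<sigma> by (metis in_set_conv_nth)
  qed
  ultimately have "summable (\<lambda>n. x (\<sigma> n))"
    using assms by (simp add: unconditionally_convergent_def bij_def)
  then have "Bseq (\<lambda>n. \<Sum>i<n. x (\<sigma> i))"
    by (simp add: convergent_imp_Bseq summable_iff_convergent)
  then obtain K where K: "\<And>n. norm (\<Sum>i<n. x (\<sigma> i)) \<le> K"
    by (auto simp: Bseq_def)
  obtain i :: nat where i: "K < real i"
    using reals_Archimedean2 by blast
  have "(\<Sum>n<length (L i). x (\<sigma> n)) = (\<Sum>n<length (L i). x (L i ! n))"
    using \<sigma> by simp
  also have "\<dots> = (\<Sum>k\<in>set (L i). x k)"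
    using L[of i] by (simp add: P_def sum.reindex_bij_betw[OF bij_betw_nth])
  finally have "real i \<le> K"
    using K[of "length (L i)"] L[of i] by (simp add: P_def)
  with i show False by simp
qed

text \<open>The index type is arbitrary so that double series can be enumerated in any order.\<close>

lemma unconditionally_convergent_if_unordered_Cauchy:
  fixes z :: "'i \<Rightarrow> 'x::banach"
  assumes cauchy: "\<And>e. e > 0 \<Longrightarrow>
      \<exists>A. finite A \<and> (\<forall>F. finite F \<longrightarrow> F \<inter> A = {} \<longrightarrow> norm (\<Sum>i\<in>F. z i) < e)"
    and h: "inj h"
  shows "unconditionally_convergent (\<lambda>n. z (h n))"
  unfolding unconditionally_convergent_def
proof (intro allI impI)
  fix \<sigma> :: "nat \<Rightarrow> nat"
  assume "bij \<sigma>"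
  then have inj: "inj (\<lambda>n. h (\<sigma> n))"
    using h by (simp add: bij_def inj_def)
  show "summable (\<lambda>n. z (h (\<sigma> n)))"
    unfolding summable_Cauchy
  proof (intro allI impI)
    fix e :: real
    assume "e > 0"
    then obtain A where A: "finite A"
      "\<And>F. finite F \<Longrightarrow> F \<inter> A = {} \<Longrightarrow> norm (\<Sum>i\<in>F. z i) < e"
      using cauchy by blast
    have "finite ((\<lambda>n. h (\<sigma> n)) -` A)"
      using A(1) inj by (rule finite_vimageI)
    then obtain N where N: "\<And>n. h (\<sigma> n) \<in> A \<Longrightarrow> n < N"
      by (auto simp: finite_nat_set_iff_bounded)
    have "norm (\<Sum>i\<in>{m..<n}. z (h (\<sigma> i))) < e" if "m \<ge> N" for m n
    proof -
      have "(\<Sum>i\<in>{m..<n}. z (h (\<sigma> i))) = (\<Sum>j\<in>(\<lambda>i. h (\<sigma> i)) ` {m..<n}. z j)"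
        using inj by (subst sum.reindex) (auto intro: inj_on_subset simp: o_def)
      moreover have "(\<lambda>i. h (\<sigma> i)) ` {m..<n} \<inter> A = {}"
        using N that by force
      ultimately show ?thesis
        using A(2) by simp
    qed
    then show "\<exists>N. \<forall>m\<ge>N. \<forall>n. norm (\<Sum>i\<in>{m..<n}. z (h (\<sigma> i))) < e"
      by blast
  qed
qed

text \<open>Of a family of finite blocks, the tail beyond block \<open>M\<close> contributes at most
  \<open>\<Sum>m\<ge>M. 1/2\<^sup>m\<close> to any finite sum.\<close>

lemma geometric_blocks_unordered_Cauchy:
  fixes z :: "nat \<times> nat \<Rightarrow> 'x::banach"
  assumes small: "\<And>m F. finite F \<Longrightarrow> norm (\<Sum>k\<in>F. z (m, k)) \<le> (1/2)^m"
    and support: "\<And>m k. k \<ge> N m \<Longrightarrow> z (m, k) = 0"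
    and e: "e > 0"
  shows "\<exists>A. finite A \<and> (\<forall>F. finite F \<longrightarrow> F \<inter> A = {} \<longrightarrow> norm (\<Sum>i\<in>F. z i) < e)"
proof -
  obtain M where M: "\<And>n. norm (\<Sum>m\<in>{M..<n}. (1/2::real)^m) < e"
    using e summable_geometric[of "1/2::real"] unfolding summable_Cauchy by force
  define A where "A = (SIGMA m:{..<M}. {..<N m})"
  have "norm (\<Sum>i\<in>F. z i) < e" if F: "finite F" "F \<inter> A = {}" for F
  proof -
    define S where "S m = {k. (m, k) \<in> F}" for m
    have "S m \<subseteq> snd ` F" for m
      by (force simp: S_def)
    then have finS: "finite (S m)" for m
      using F(1) finite_subset[of "S m" "snd ` F"] by simp
    obtain n where n: "fst ` F \<subseteq> {..<n}"
      using F(1) by (meson finite_imageI finite_nat_iff_bounded)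
    then have eq: "F = (SIGMA m:{..<n}. S m)"
      by (auto simp: S_def)
    have "(\<Sum>i\<in>F. z i) = (\<Sum>m<n. \<Sum>k\<in>S m. z (m, k))"
      using finS by (subst eq) (simp add: sum.Sigma)
    also have "\<dots> = (\<Sum>m\<in>{M..<n}. \<Sum>k\<in>S m. z (m, k))"
    proof (rule sum.mono_neutral_right)
      show "\<forall>m\<in>{..<n} - {M..<n}. (\<Sum>k\<in>S m. z (m, k)) = 0"
      proof
        fix m
        assume "m \<in> {..<n} - {M..<n}"
        then show "(\<Sum>k\<in>S m. z (m, k)) = 0"
          using F(2) by (intro sum.neutral ballI support) (force simp: A_def S_def)
      qed
    qed auto
    finally have "norm (\<Sum>i\<in>F. z i) \<le> (\<Sum>m\<in>{M..<n}. norm (\<Sum>k\<in>S m. z (m, k)))"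
      by (simp add: norm_sum)
    also have "\<dots> \<le> (\<Sum>m\<in>{M..<n}. (1/2)^m)"
      by (intro sum_mono small finS)
    also have "\<dots> < e"
      using M[of n] by simp
    finally show ?thesis .
  qed
  moreover have "finite A"
    by (simp add: A_def)
  ultimately show ?thesis by blast
qed

text \<open>If no bound existed, then for each \<open>m\<close> there would be a finite family with subsums in the
  unit ball and \<open>\<Sum>\<parallel>T x\<^sub>k\<parallel> > 4\<^sup>m\<close>. Scaled by \<open>1/2\<^sup>m\<close> and combined, these families give an
  unconditionally convergent series whose \<open>m\<close>-th block has \<open>\<Sum>\<parallel>T x\<^sub>k\<parallel> > 2\<^sup>m\<close>.\<close>

lemma absolutely_summing_finite_bound:
  fixes T :: "'x::banach \<Rightarrow> 'z::real_normed_vector"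
  assumes T: "linear T"
    and summing: "\<And>x. unconditionally_convergent x \<Longrightarrow> summable (\<lambda>n. norm (T (x n)))"
  obtains C where "\<forall>n x. (\<forall>F\<subseteq>{..<n}. norm (\<Sum>k\<in>F. x k) \<le> 1) \<longrightarrow>
    (\<Sum>k<n::nat. norm (T (x k))) \<le> C"
proof (rule ccontr)
  assume "\<not> thesis"
  then have "\<exists>n x. (\<forall>F\<subseteq>{..<n}. norm (\<Sum>k\<in>F. x k) \<le> 1) \<and> (\<Sum>k<n::nat. norm (T (x k))) > 4^m"
    for m :: nat
    using that by (meson not_le)
  then obtain N X where X: "\<And>m F. F \<subseteq> {..<N m} \<Longrightarrow> norm (\<Sum>k\<in>F. X m k) \<le> 1"
    and TX: "\<And>m. (\<Sum>k<N m::nat. norm (T (X m k))) > 4^m"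
    by metis
  define z where "z = (\<lambda>(m, k). if k < N m then (1/2)^m *\<^sub>R X m k else 0)"
  have small: "norm (\<Sum>k\<in>F. z (m, k)) \<le> (1/2)^m" if "finite F" for m F
  proof -
    have "(\<Sum>k\<in>F. z (m, k)) = (\<Sum>k\<in>F \<inter> {..<N m}. (1/2)^m *\<^sub>R X m k)"
      using that by (simp add: z_def sum.inter_restrict lessThan_def)
    also have "\<dots> = (1/2)^m *\<^sub>R (\<Sum>k\<in>F \<inter> {..<N m}. X m k)"
      by (simp add: scaleR_sum_right)
    finally show ?thesis
      using X[of "F \<inter> {..<N m}" m] by simp
  qed
  have "unconditionally_convergent (\<lambda>n. z (prod_decode n))"
  proof (rule unconditionally_convergent_if_unordered_Cauchy[of z])
    show "\<exists>A. finite A \<and> (\<forall>F. finite F \<longrightarrow> F \<inter> A = {} \<longrightarrow> norm (\<Sum>i\<in>F. z i) < e)"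
      if "e > 0" for e :: real
      by (rule geometric_blocks_unordered_Cauchy[where N = N]) (use small that in \<open>auto simp: z_def\<close>)
  qed (rule inj_prod_decode)
  then have sm: "summable (\<lambda>n. norm (T (z (prod_decode n))))"
    by (rule summing)
  define S where "S = (\<Sum>n. norm (T (z (prod_decode n))))"
  obtain m :: nat where m: "S < 2^m"
    using real_arch_pow[of 2 S] by auto
  have "2^m = (1/2)^m * (4::real)^m"
    by (simp flip: power_mult_distrib)
  also have "\<dots> \<le> (1/2)^m * (\<Sum>k<N m. norm (T (X m k)))"
    using TX[of m] by (intro mult_left_mono) auto
  also have "\<dots> = (\<Sum>k<N m. norm (T (z (m, k))))"
    by (simp add: z_def linear_cmul[OF T] sum_distrib_left)
  also have "\<dots> = (\<Sum>n\<in>(\<lambda>k. prod_encode (m, k)) ` {..<N m}. norm (T (z (prod_decode n))))"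
    by (subst sum.reindex) (auto simp: inj_on_def)
  also have "\<dots> \<le> S"
    unfolding S_def by (rule sum_le_suminf[OF sm]) auto
  finally show False
    using m by simp
qed

section \<open>Uniform boundedness on a closed subspace\<close>

text \<open>The closed sets on which all operators are bounded by \<open>n\<close> cover the subspace \<open>V\<close>, which is
  completely metrizable. By Baire's theorem one of them contains a ball of \<open>V\<close>, and translating
  this ball to the origin gives the uniform bound.\<close>

lemma uniform_boundedness:
  fixes V :: "'v::banach set" and \<T> :: "('v \<Rightarrow>\<^sub>L 'w::real_normed_vector) set"
  assumes V: "subspace V" "closed V"
    and pointwise: "\<And>v. v \<in> V \<Longrightarrow> \<exists>C. \<forall>T\<in>\<T>. norm (blinfun_apply T v) \<le> C"
  obtains K where "\<And>T v. T \<in> \<T> \<Longrightarrow> v \<in> V \<Longrightarrow> norm (blinfun_apply T v) \<le> K * norm v"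
proof -
  let ?X = "top_of_set V"
  define B where "B n = {v \<in> V. \<forall>T\<in>\<T>. norm (blinfun_apply T v) \<le> real n}" for n
  have closed_B: "closedin ?X (B n)" for n
  proof -
    have "B n = V \<inter> (\<Inter>T\<in>\<T>. {v. norm (blinfun_apply T v) \<le> real n})"
      by (auto simp: B_def)
    moreover have "closed (\<Inter>T\<in>\<T>. {v. norm (blinfun_apply T v) \<le> real n})"
      by (intro closed_INT ballI closed_Collect_le continuous_intros)
    ultimately show ?thesis
      using closedin_closed by blast
  qed
  have cover: "\<Union>(range B) = V"
  proof
    show "V \<subseteq> \<Union>(range B)"
    proof
      fix v
      assume v: "v \<in> V"
      then obtain C where "\<forall>T\<in>\<T>. norm (blinfun_apply T v) \<le> C"
        using pointwise by blast
      moreover obtain n :: nat where "C \<le> real n"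
        using real_arch_simple by blast
      ultimately show "v \<in> \<Union>(range B)"
        using v by (auto simp: B_def intro: order_trans)
    qed
  qed (auto simp: B_def)
  have "completely_metrizable_space ?X"
    using V(2) completely_metrizable_space_closedin completely_metrizable_space_euclidean
    by (metis closed_closedin)
  moreover have "?X interior_of \<Union>(range B) \<noteq> {}"
    using subspace_0[OF V(1)] interior_of_topspace[of ?X] by (auto simp: cover)
  ultimately obtain n where "?X interior_of (B n) \<noteq> {}"
    using Baire_category_alt[of ?X "range B"] closed_B by fastforce
  then obtain v0 U where U: "openin ?X U" "v0 \<in> U" "U \<subseteq> B n"
    by (auto simp: interior_of_def)
  then obtain e where e: "e > 0" "\<And>v. v \<in> V \<Longrightarrow> dist v v0 < e \<Longrightarrow> v \<in> U"
    by (metis openin_euclidean_subtopology_iff)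
  have v0: "v0 \<in> V" "v0 \<in> B n"
    using U by (auto simp: B_def)
  show thesis
  proof (rule that)
    fix T v
    assume T: "T \<in> \<T>" and v: "v \<in> V"
    show "norm (blinfun_apply T v) \<le> (4 * real n / e) * norm v"
    proof (cases "v = 0")
      case False
      define r where "r = e / (2 * norm v)"
      have r: "r > 0" using e(1) False by (simp add: r_def)
      have "v0 + r *\<^sub>R v \<in> V"
        using v v0(1) V(1) by (simp add: subspace_add subspace_scale)
      moreover have "dist (v0 + r *\<^sub>R v) v0 < e"
        using e(1) False by (simp add: dist_norm r_def)
      ultimately have "v0 + r *\<^sub>R v \<in> B n"
        using e(2) U(3) by blast
      then have "norm (blinfun_apply T (v0 + r *\<^sub>R v)) \<le> real n" "norm (blinfun_apply T v0) \<le> real n"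
        using v0(2) T by (auto simp: B_def)
      moreover have "blinfun_apply T (r *\<^sub>R v) = blinfun_apply T (v0 + r *\<^sub>R v) - blinfun_apply T v0"
        by (simp add: blinfun.add_right)
      ultimately have "norm (blinfun_apply T (r *\<^sub>R v)) \<le> 2 * real n"
        using norm_triangle_ineq4[of "blinfun_apply T (v0 + r *\<^sub>R v)" "blinfun_apply T v0"] by simp
      then have "r * norm (blinfun_apply T v) \<le> 2 * real n"
        using r by (simp add: blinfun.scaleR_right)
      then show ?thesis
        using e(1) False by (simp add: r_def field_simps)
    qed simp
  qed
qed

section \<open>Functionals on Banach spaces\<close>

text \<open>This turns \<open>\<parallel>\<Sum>k. \<phi>\<^sub>k a\<^sub>k\<parallel>\<close> into \<open>\<Sum>k. \<parallel>\<phi>\<^sub>k a\<^sub>k\<parallel>\<close>: scaling by a scalar of modulus \<open>1\<close> makes the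
  value at a nearly norming vector real and nonnegative.\<close>

lemma (in banach_space_over) dual_space_nearly_norming_vector:
  assumes "\<phi> \<in> dual_space scale"
  obtains a r where "norm a \<le> 1" "r \<ge> 0" "blinfun_apply \<phi> a = of_real r" "norm \<phi> \<le> 2 * r"
proof (cases "\<phi> = 0")
  case True
  then show thesis using that[of 0 0] by simp
next
  case False
  interpret \<phi>: Vector_Spaces.linear scale "(*)" "blinfun_apply \<phi>"
    using assms by (simp add: dual_space_def)
  have "\<exists>a. norm (blinfun_apply \<phi> a) > norm \<phi> / 2 * norm a"
  proof (rule ccontr)
    assume "\<nexists>a. norm (blinfun_apply \<phi> a) > norm \<phi> / 2 * norm a"
    then have "norm \<phi> \<le> norm \<phi> / 2"
      by (intro norm_blinfun_bound) (auto simp: not_less)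
    then show False using False by simp
  qed
  then obtain a where a: "norm (blinfun_apply \<phi> a) > norm \<phi> / 2 * norm a"
    by blast
  define v where "v = blinfun_apply \<phi> a"
  define r where "r = norm v / norm a"
  define c where "c = of_real r / v"
  have "0 \<le> norm \<phi> / 2 * norm a"
    by simp
  then have "norm v > 0"
    using a unfolding v_def by linarith
  then have nz: "a \<noteq> 0" "v \<noteq> 0"
    by (auto simp: v_def)
  show thesis
  proof (rule that)
    show "norm (scale c a) \<le> 1"
      using nz by (simp add: norm_scale c_def r_def norm_divide norm_mult)
    show "blinfun_apply \<phi> (scale c a) = of_real r"
      using nz by (simp add: \<phi>.scale c_def v_def)
    show "norm \<phi> \<le> 2 * r"
      using a nz by (simp add: r_def v_def field_simps)
  qed (simp add: r_def)
qed

lemma norming_imp_bounded: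
  assumes "norming E"
    and bound: "\<And>f y. f \<in> E \<Longrightarrow> norm f = 1 \<Longrightarrow> y \<in> S \<Longrightarrow> norm (blinfun_apply f y) \<le> K"
  obtains C where "\<And>y. y \<in> S \<Longrightarrow> norm y \<le> C"
proof -
  obtain c where c: "\<And>y. norm y \<le> c * (SUP f\<in>{e \<in> E. norm e = 1}. norm (blinfun_apply f y))"
    using assms(1) unfolding norming_def by blast
  show thesis
  proof (rule that)
    fix y
    assume y: "y \<in> S"
    define s where "s = (SUP f\<in>{e \<in> E. norm e = 1}. norm (blinfun_apply f y))"
    \<comment> \<open>If the unit sphere of \<open>E\<close> is empty, then \<open>s\<close> is the constant \<open>Sup {}\<close>.\<close>
    have "\<bar>s\<bar> \<le> max K \<bar>Sup {}\<bar>"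
    proof (cases "{e \<in> E. norm e = 1} = {}")
      case True
      show ?thesis unfolding s_def True by simp
    next
      case False
      then obtain f where f: "f \<in> E" "norm f = 1" by blast
      have "s \<le> K"
        unfolding s_def using False bound y by (intro cSUP_least) auto
      moreover have "norm (blinfun_apply f y) \<le> s"
        unfolding s_def using f bound y
        by (intro cSUP_upper bdd_aboveI2[where M = K]) auto
      then have "0 \<le> s"
        using norm_ge_zero order_trans by blast
      ultimately show ?thesis by simp
    qed
    then have "\<bar>c * s\<bar> \<le> \<bar>c\<bar> * max K \<bar>Sup {}\<bar>"
      unfolding abs_mult by (rule mult_left_mono) simp
    with c[of y] show "norm y \<le> \<bar>c\<bar> * max K \<bar>Sup {}\<bar>"
      by (simp add: s_def)
  qed
qed

section \<open>Unconditional actions\<close>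

context banach_action
begin

lemma act_zero_left [simp]: "act 0 x = 0"
  by (rule linear_0[OF bounded_linear.linear[OF bounded_linear_act_left]])

lemma act_scaleR_left: "act (r *\<^sub>R a) x = r *\<^sub>R act a x"
  by (rule linear_cmul[OF bounded_linear.linear[OF bounded_linear_act_left]])

lemma act_scaleR_right: "act a (r *\<^sub>R x) = r *\<^sub>R act a x"
proof -
  interpret R: Vector_Spaces.linear sX sY "\<lambda>x. act a x" by (rule linear_right)
  show ?thesis
    using R.scale[of "of_real r" x] by (simp add: X.scale_of_real Y.scale_of_real)
qed

lemma act_zero_right [simp]: "act a 0 = 0"
  using act_scaleR_right[of a 0 0] by simp

lemma D_operator_linear:
  assumes "f \<in> dual_space sY"
  shows "Vector_Spaces.linear sX dual_scale (D_operator act f)"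
proof -
  interpret f: Vector_Spaces.linear sY "(*)" "blinfun_apply f"
    using assms by (simp add: dual_space_def)
  interpret D: vector_space "dual_scale :: 'f \<Rightarrow> ('a \<Rightarrow>\<^sub>L 'f) \<Rightarrow> _"
    by (rule vector_space_dual_scale)
  show ?thesis
  proof
    fix c x y
    show "D_operator act f (x + y) = D_operator act f x + D_operator act f y"
    proof (rule blinfun_eqI)
      fix a
      interpret R: Vector_Spaces.linear sX sY "\<lambda>x. act a x" by (rule linear_right)
      show "D_operator act f (x + y) a = (D_operator act f x + D_operator act f y) a"
        by (simp add: D_operator_apply R.add f.add blinfun.add_left)
    qed
    show "D_operator act f (sX c x) = dual_scale c (D_operator act f x)"
    proof (rule blinfun_eqI)
      fix a
      interpret R: Vector_Spaces.linear sX sY "\<lambda>x. act a x" by (rule linear_right)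
      show "D_operator act f (sX c x) a = dual_scale c (D_operator act f x) a"
        by (simp add: D_operator_apply R.scale f.scale)
    qed
  qed
qed

lemma D_operator_real_linear:
  assumes "f \<in> dual_space sY"
  shows "linear (D_operator act f)"
proof (rule linearI)
  interpret D: Vector_Spaces.linear sX dual_scale "D_operator act f"
    by (rule D_operator_linear[OF assms])
  show "D_operator act f (x + y) = D_operator act f x + D_operator act f y" for x y
    by (rule D.add)
  show "D_operator act f (r *\<^sub>R x) = r *\<^sub>R D_operator act f x" for r x
    by (rule blinfun_eqI)
      (simp add: D_operator_apply act_scaleR_right blinfun.scaleR_left blinfun.scaleR_right)
qed

text \<open>By bilinearity \<open>a\<close> and \<open>x\<close> may be divided by their maxima; if one of these is \<open>0\<close>, then every
  term \<open>a\<^sub>k x\<^sub>k\<close> vanishes.\<close>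

lemma unconditional_action_normalised:
  "unconditional_action act \<longleftrightarrow>
    (\<exists>C. \<forall>(n::nat) a x. (\<forall>k<n. norm (a k) \<le> 1) \<longrightarrow> (\<forall>F\<subseteq>{..<n}. norm (\<Sum>k\<in>F. x k) \<le> 1)
      \<longrightarrow> norm (\<Sum>k<n. act (a k) (x k)) \<le> C)"
  (is "_ \<longleftrightarrow> (\<exists>C. ?bound C)")
proof
  assume "unconditional_action act"
  then obtain C where C: "C > 0" and un: "\<And>(n::nat) a x. n \<ge> 1 \<Longrightarrow> norm (\<Sum>k<n. act (a k) (x k))
        \<le> C * (MAX k\<in>{..<n}. norm (a k)) * (MAX F\<in>Pow {..<n}. norm (\<Sum>k\<in>F. x k))"
    unfolding unconditional_action_def by blast
  have "?bound C"
  proof (intro allI impI)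
    fix n :: nat and a :: "nat \<Rightarrow> 'a" and x :: "nat \<Rightarrow> 'x"
    assume a: "\<forall>k<n. norm (a k) \<le> 1" and x: "\<forall>F\<subseteq>{..<n}. norm (\<Sum>k\<in>F. x k) \<le> 1"
    show "norm (\<Sum>k<n. act (a k) (x k)) \<le> C"
    proof (cases "n = 0")
      case False
      have "(MAX k\<in>{..<n}. norm (a k)) \<le> 1"
        using a False by (subst Max_le_iff) auto
      moreover have "(MAX F\<in>Pow {..<n}. norm (\<Sum>k\<in>F. x k)) \<le> 1"
        using x by (subst Max_le_iff) auto
      moreover have "0 \<le> (MAX F\<in>Pow {..<n}. norm (\<Sum>k\<in>F. x k))"
        by (intro Max_ge) (auto intro!: image_eqI[of _ _ "{}"])
      ultimately have "C * (MAX k\<in>{..<n}. norm (a k)) * (MAX F\<in>Pow {..<n}. norm (\<Sum>k\<in>F. x k))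
          \<le> C * 1 * 1"
        using C by (intro mult_mono[OF mult_left_mono]) auto
      with un[of n a x] False show ?thesis by simp
    qed (use C in simp)
  qed
  then show "\<exists>C. ?bound C" by blast
next
  assume "\<exists>C. ?bound C"
  then obtain C where C: "?bound C" by blast
  have "norm (\<Sum>k<n. act (a k) (x k)) \<le>
      max C 1 * (MAX k\<in>{..<n}. norm (a k)) * (MAX F\<in>Pow {..<n}. norm (\<Sum>k\<in>F. x k))"
    if n: "n \<ge> 1" for n and a :: "nat \<Rightarrow> 'a" and x :: "nat \<Rightarrow> 'x"
  proof -
    define \<alpha> where "\<alpha> = (MAX k\<in>{..<n}. norm (a k))"
    define \<beta> where "\<beta> = (MAX F\<in>Pow {..<n}. norm (\<Sum>k\<in>F. x k))"
    have a: "norm (a k) \<le> \<alpha>" if "k < n" for k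
      unfolding \<alpha>_def using that by (intro Max_ge) auto
    have x: "norm (\<Sum>k\<in>F. x k) \<le> \<beta>" if "F \<subseteq> {..<n}" for F
      unfolding \<beta>_def using that by (intro Max_ge) auto
    have "0 \<le> \<alpha>"
      using order_trans[OF norm_ge_zero a[of 0]] n by simp
    have "0 \<le> \<beta>"
      using x[of "{}"] by simp
    show ?thesis
    proof (cases "\<alpha> = 0 \<or> \<beta> = 0")
      case True
      have "act (a k) (x k) = 0" if "k < n" for k
        using True a[OF that] x[of "{k}"] that by auto
      then have "(\<Sum>k<n. act (a k) (x k)) = 0"
        by simp
      then show ?thesis
        using True by (auto simp flip: \<alpha>_def \<beta>_def)
    next
      case False
      then have pos: "\<alpha> > 0" "\<beta> > 0"
        using \<open>0 \<le> \<alpha>\<close> \<open>0 \<le> \<beta>\<close> by auto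
      have "norm (\<Sum>k<n. act ((1/\<alpha>) *\<^sub>R a k) ((1/\<beta>) *\<^sub>R x k)) \<le> C"
      proof (rule C[rule_format])
        show "norm ((1/\<alpha>) *\<^sub>R a k) \<le> 1" if "k < n" for k
          using a[OF that] pos by simp
        show "norm (\<Sum>k\<in>F. (1/\<beta>) *\<^sub>R x k) \<le> 1" if "F \<subseteq> {..<n}" for F
          using x[OF that] pos by (simp flip: scaleR_sum_right)
      qed
      moreover have "(\<Sum>k<n. act ((1/\<alpha>) *\<^sub>R a k) ((1/\<beta>) *\<^sub>R x k))
          = (1 / (\<alpha> * \<beta>)) *\<^sub>R (\<Sum>k<n. act (a k) (x k))"
        by (simp add: act_scaleR_left act_scaleR_right scaleR_sum_right mult.commute)
      ultimately have "norm (\<Sum>k<n. act (a k) (x k)) \<le> C * (\<alpha> * \<beta>)"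
        using pos by (simp add: field_simps)
      also have "\<dots> \<le> max C 1 * (\<alpha> * \<beta>)"
        using pos by (intro mult_right_mono) auto
      finally show ?thesis
        by (simp add: mult.assoc flip: \<alpha>_def \<beta>_def)
    qed
  qed
  then show "unconditional_action act"
    unfolding unconditional_action_def by (intro exI[of _ "max C 1"]) auto
qed

text \<open>Nearly norming vectors \<open>a\<^sub>k\<close> for the functionals \<open>D\<^sub>f x\<^sub>k\<close> give
  \<open>\<Sum>k<n. \<parallel>D\<^sub>f x\<^sub>k\<parallel> \<le> 2 \<parallel>f\<parallel> \<parallel>\<Sum>k<n. a\<^sub>k x\<^sub>k\<parallel>\<close>, and the norm on the right is controlled by the
  subsums of \<open>x\<close>. For unconditionally convergent series this yields summability, and for families
  of length one the continuity of \<open>D\<^sub>f\<close>.\<close>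

lemma unconditional_imp_absolutely_summing:
  assumes un: "unconditional_action act" and f: "f \<in> dual_space sY"
  shows "absolutely_summing sX dual_scale (D_operator act f)"
  unfolding absolutely_summing_def
proof (intro conjI allI impI)
  let ?D = "D_operator act f"
  show "Vector_Spaces.linear sX dual_scale ?D"
    by (rule D_operator_linear[OF f])
  obtain C where C: "\<And>(n::nat) a x. (\<And>k. k < n \<Longrightarrow> norm (a k) \<le> 1) \<Longrightarrow>
      (\<And>F. F \<subseteq> {..<n} \<Longrightarrow> norm (\<Sum>k\<in>F. x k) \<le> 1) \<Longrightarrow> norm (\<Sum>k<n. act (a k) (x k)) \<le> C"
    using un unfolding unconditional_action_normalised by blast
  have bound: "(\<Sum>k<n. norm (?D (x k))) \<le> 2 * norm f * C * M"
    if M: "M > 0" "\<And>F. F \<subseteq> {..<n} \<Longrightarrow> norm (\<Sum>k\<in>F. x k) \<le> M" for n :: nat and x M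
  proof -
    have "\<exists>a r. norm a \<le> 1 \<and> r \<ge> 0 \<and> f (act a (x k)) = of_real r \<and> norm (?D (x k)) \<le> 2 * r" for k
      using A.dual_space_nearly_norming_vector[OF D_operator_in_dual_space[OF f, of "x k"]]
      by (metis D_operator_apply)
    then obtain a r where a: "\<And>k. norm (a k) \<le> 1" and r: "\<And>k. r k \<ge> 0"
      and fa: "\<And>k. f (act (a k) (x k)) = of_real (r k)"
      and D: "\<And>k. norm (?D (x k)) \<le> 2 * r k"
      by metis
    have "norm (\<Sum>k<n. act (a k) ((1/M) *\<^sub>R x k)) \<le> C"
      using a M by (intro C) (simp_all flip: scaleR_sum_right)
    then have act: "norm (\<Sum>k<n. act (a k) (x k)) \<le> C * M"
      using M(1) by (simp add: act_scaleR_right field_simps flip: scaleR_sum_right)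
    have "(\<Sum>k<n. norm (?D (x k))) \<le> (\<Sum>k<n. 2 * r k)"
      by (intro sum_mono D)
    also have "\<dots> = 2 * norm (of_real (\<Sum>k<n. r k) :: 'f)"
      using r by (simp add: sum_nonneg del: of_real_sum flip: sum_distrib_left)
    also have "\<dots> = 2 * norm (f (\<Sum>k<n. act (a k) (x k)))"
      by (simp add: fa blinfun.sum_right)
    also have "\<dots> \<le> 2 * (norm f * (C * M))"
      using norm_blinfun[of f "\<Sum>k<n. act (a k) (x k)"] mult_left_mono[OF act, of "norm f"] by simp
    finally show ?thesis by (simp add: mult.assoc)
  qed
  have "norm (?D x) \<le> norm x * (2 * norm f * C)" for x
  proof (cases "x = 0")
    case True
    then show ?thesis using linear_0[OF D_operator_real_linear[OF f]] by simp
  next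
    case False
    have "norm (\<Sum>k\<in>F. x) \<le> norm x" if "F \<subseteq> {..<1::nat}" for F
      using that by (cases "F = {}") (auto simp: lessThan_Suc subset_singleton_iff)
    then show ?thesis
      using bound[of "norm x" 1 "\<lambda>_. x"] False by (simp add: mult.commute)
  qed
  then have "bounded_linear ?D"
    using D_operator_real_linear[OF f] by (intro bounded_linear_intro) (auto simp: linear_add linear_cmul)
  then show "continuous_on UNIV ?D"
    by (rule linear_continuous_on)
  fix x :: "nat \<Rightarrow> 'x"
  assume "unconditionally_convergent x"
  then obtain M where M: "\<And>F. finite F \<Longrightarrow> norm (\<Sum>k\<in>F. x k) \<le> M"
    using unconditionally_convergent_finite_sums_bounded by blast
  have "(\<Sum>k<n. norm (?D (x k))) \<le> 2 * norm f * C * max M 1" for n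
    using M finite_subset[OF _ finite_lessThan] by (intro bound) (auto simp: le_max_iff_disj)
  then show "summable (\<lambda>n. norm (?D (x n)))"
    by (intro bounded_imp_summable[where B = "2 * norm f * C * max M 1"])
      (auto simp del: sum.lessThan_Suc simp flip: lessThan_Suc_atMost)
qed

end

section \<open>The characterisation\<close>

theorem theorem3p3:
  fixes sA :: "'f::{real_normed_field, banach} \<Rightarrow> 'a::banach \<Rightarrow> 'a"
    and sX :: "'f \<Rightarrow> 'x::banach \<Rightarrow> 'x"
    and sY :: "'f \<Rightarrow> 'y::banach \<Rightarrow> 'y"
    and act :: "'a \<Rightarrow> 'x \<Rightarrow> 'y"
    and E :: "('y \<Rightarrow>\<^sub>L 'f) set"
  assumes "banach_action sA sX sY act"
    and "E \<subseteq> dual_space sY"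
    and "module.subspace dual_scale E"
    and "closed E"
    and "norming E"
  shows "unconditional_action act \<longleftrightarrow>
    (\<forall>f\<in>E. absolutely_summing sX dual_scale (D_operator act f))"
proof
  interpret banach_action sA sX sY act by fact
  show "\<forall>f\<in>E. absolutely_summing sX dual_scale (D_operator act f)"
    if "unconditional_action act"
    using that assms(2) unconditional_imp_absolutely_summing by blast
next
  interpret banach_action sA sX sY act by fact
  interpret D: vector_space "dual_scale :: 'f \<Rightarrow> ('y \<Rightarrow>\<^sub>L 'f) \<Rightarrow> _"
    by (rule vector_space_dual_scale)
  assume summing: "\<forall>f\<in>E. absolutely_summing sX dual_scale (D_operator act f)"
  \<comment> \<open>The action is unconditional iff this set is bounded in norm.\<close>
  define S where "S = {\<Sum>k<n. act (a k) (x k) | (n::nat) a x.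
    (\<forall>k<n. norm (a k) \<le> 1) \<and> (\<forall>F\<subseteq>{..<n}. norm (\<Sum>k\<in>F. x k) \<le> 1)}"
  have pointwise: "\<exists>C. \<forall>y\<in>S. norm (blinfun_apply f y) \<le> C" if f: "f \<in> E" for f
  proof -
    let ?D = "D_operator act f"
    have "linear ?D"
      using f assms(2) by (intro D_operator_real_linear) auto
    moreover have "summable (\<lambda>n. norm (?D (x n)))" if "unconditionally_convergent x" for x
      using summing f that by (auto simp: absolutely_summing_def)
    ultimately obtain C where C: "\<forall>n x. (\<forall>F\<subseteq>{..<n}. norm (\<Sum>k\<in>F. x k) \<le> 1) \<longrightarrow>
        (\<Sum>k<n::nat. norm (?D (x k))) \<le> C"
      using absolutely_summing_finite_bound by blast
    have "norm (blinfun_apply f (\<Sum>k<n. act (a k) (x k))) \<le> C"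
      if a: "\<forall>k<n. norm (a k) \<le> 1" and x: "\<forall>F\<subseteq>{..<n}. norm (\<Sum>k\<in>F. x k) \<le> 1" for n :: nat and a x
    proof -
      have "norm (blinfun_apply f (\<Sum>k<n. act (a k) (x k))) \<le> (\<Sum>k<n. norm (?D (x k) (a k)))"
        by (simp add: D_operator_apply blinfun.sum_right norm_sum)
      also have "\<dots> \<le> (\<Sum>k<n. norm (?D (x k)))"
      proof (rule sum_mono)
        fix k
        assume "k \<in> {..<n}"
        then have "norm (?D (x k)) * norm (a k) \<le> norm (?D (x k))"
          using a by (intro mult_left_le) auto
        then show "norm (?D (x k) (a k)) \<le> norm (?D (x k))"
          using norm_blinfun order_trans by blast
      qed
      also have "\<dots> \<le> C"
        using x C by blast
      finally show ?thesis .
    qed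
    then show ?thesis
      unfolding S_def by (intro exI[of _ C]) blast
  qed
  have "subspace E"
    unfolding subspace_def
  proof (intro conjI ballI allI)
    show "0 \<in> E" "\<And>f g. f \<in> E \<Longrightarrow> g \<in> E \<Longrightarrow> f + g \<in> E"
      using assms(3) by (auto simp: D.subspace_def)
    fix r and f :: "'y \<Rightarrow>\<^sub>L 'f"
    assume "f \<in> E"
    then have "dual_scale (of_real r) f \<in> E"
      using assms(3) by (auto simp: D.subspace_def)
    moreover have "dual_scale (of_real r) f = r *\<^sub>R f"
      by (rule blinfun_eqI) (simp add: blinfun.scaleR_left scaleR_conv_of_real)
    ultimately show "r *\<^sub>R f \<in> E" by simp
  qed
  moreover define ev :: "'y \<Rightarrow> ('y \<Rightarrow>\<^sub>L 'f) \<Rightarrow>\<^sub>L 'f" where "ev y = Blinfun (\<lambda>f. blinfun_apply f y)" for y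
  have ev: "blinfun_apply (ev y) f = blinfun_apply f y" for y f
    unfolding ev_def by (subst bounded_linear_Blinfun_apply) (auto intro: blinfun.bounded_linear_left)
  have "\<exists>C. \<forall>T\<in>ev ` S. norm (blinfun_apply T f) \<le> C" if "f \<in> E" for f
    using pointwise[OF that] by (simp add: ev)
  ultimately obtain K where
    K: "\<And>T f. T \<in> ev ` S \<Longrightarrow> f \<in> E \<Longrightarrow> norm (blinfun_apply T f) \<le> K * norm f"
    using uniform_boundedness[of E "ev ` S"] assms(4) by blast
  have "norm (blinfun_apply f y) \<le> K" if "f \<in> E" "norm f = 1" "y \<in> S" for f y
    using K[of "ev y" f] that by (simp add: ev)
  then obtain C where "\<And>y. y \<in> S \<Longrightarrow> norm y \<le> C"
    using norming_imp_bounded[OF assms(5), of S K] by blast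
  then have "\<forall>(n::nat) a x. (\<forall>k<n. norm (a k) \<le> 1) \<longrightarrow> (\<forall>F\<subseteq>{..<n}. norm (\<Sum>k\<in>F. x k) \<le> 1)
      \<longrightarrow> norm (\<Sum>k<n. act (a k) (x k)) \<le> C"
    unfolding S_def by blast
  then show "unconditional_action act"
    unfolding unconditional_action_normalised by blast
qed

end
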